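(* Let $\mathfrak{F}$ be a hereditary formation of finite groups and let $\Sigma$ be a subgroup functor. Then for every finite group $G$, $\mathrm{SI}_{\Sigma}^{\mathfrak{F}}(G)$ is the product of all normal subgroups $N$ of $G$ such that $H$ is $\mathfrak{F}$-subnormal in $HN$ for every $H\in\Sigma(G)$.
   Context: All groups are finite. Classes of groups are closed under isomorphism. A formation is a class of groups $\mathfrak{X}$ closed under quotients and such that $H/A, H/B\in\mathfrak{X}$ (with $A,B$ normal in $H$) implies $H/(A\cap B)\in\mathfrak{X}$. A class $\mathfrak{X}$ is hereditary if it is closed under subgroups. A subgroup functor is a function $\tau$ which assigns to each group $G$ a possibly empty set $\tau(G)$ of subgroups of $G$ such that $f(\tau(G))=\tau(f(G))$ for any isomorphism $f:G\to G^*$. A subgroup $H$ of $G$ is $\mathfrak{F}$-subnormal in $G$ if either $H=G$ or there is a maximal chain of subgroups $H=H_0<H_1<\dots<H_n=G$ (each $H_{i-1}$ maximal in $H_i$) such that $H_i/\mathrm{Core}_{H_i}(H_{i-1})\in\mathfrak{F}$ for all $i=1,\dots,n$. An $\mathfrak{F}$-subnormalizer of a subgroup $H$ of $G$ is a subgroup $T$ of $G$ such that $H$ is $\mathfrak{F}$-subnormal in $T$ and, whenever $T\le M\le G$ and $H$ is $\mathfrak{F}$-subnormal in $M$, one has $T=M$. (It always exists but need not be unique.) $\mathrm{SI}_{\Sigma}^{\mathfrak{F}}(G)$ denotes the intersection of all $\mathfrak{F}$-subnormalizers in $G$ of all subgroups $H\in\Sigma(G)$ (an empty intersection is understood to be $G$).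 *)

theory Defs
  imports "HOL-Algebra.Algebra"
begin

definition finite_group :: "('a, 'b) monoid_scheme \<Rightarrow> bool" where
  "finite_group G \<longleftrightarrow> group G \<and> finite (carrier G)"

(* A class of finite groups is represented by its members whose carriers consist of natural
   numbers. Every finite group is isomorphic to such a group, so nothing is lost; in_class
   is membership for a group over an arbitrary type (for example a quotient group). *)

definition group_class :: "nat monoid set \<Rightarrow> bool" where
  "group_class \<FF> \<longleftrightarrow>
     (\<forall>G\<in>\<FF>. finite_group G) \<and>
     (\<forall>G\<in>\<FF>. \<forall>H :: nat monoid. group H \<and> G \<cong> H \<longrightarrow> H \<in> \<FF>)"

definition in_class :: "('a, 'b) monoid_scheme \<Rightarrow> nat monoid set \<Rightarrow> bool" where
  "in_class G \<FF> \<longleftrightarrow> group G \<and> (\<exists>K\<in>\<FF>. G \<cong> K)"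

definition formation :: "nat monoid set \<Rightarrow> bool" where
  "formation \<FF> \<longleftrightarrow>
     group_class \<FF> \<and>
     (\<forall>H\<in>\<FF>. \<forall>N. N \<lhd> H \<longrightarrow> in_class (H Mod N) \<FF>) \<and>
     (\<forall>(H :: nat monoid) A B. finite_group H \<and> A \<lhd> H \<and> B \<lhd> H \<and>
        in_class (H Mod A) \<FF> \<and> in_class (H Mod B) \<FF> \<longrightarrow> in_class (H Mod (A \<inter> B)) \<FF>)"

definition hereditary :: "nat monoid set \<Rightarrow> bool" where
  "hereditary \<FF> \<longleftrightarrow> (\<forall>G\<in>\<FF>. \<forall>H. subgroup H G \<longrightarrow> G\<lparr>carrier := H\<rparr> \<in> \<FF>)"

(* A functor on all finite groups restricts to one on the finite groups with elements in 'a. *)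
definition subgroup_functor :: "('a monoid \<Rightarrow> 'a set set) \<Rightarrow> bool" where
  "subgroup_functor \<tau> \<longleftrightarrow>
     (\<forall>G. finite_group G \<longrightarrow> (\<forall>H\<in>\<tau> G. subgroup H G)) \<and>
     (\<forall>G G' f. finite_group G \<and> finite_group G' \<and> f \<in> iso G G' \<longrightarrow> (\<lambda>H. f ` H) ` \<tau> G = \<tau> G')"

definition maximal_subgroup :: "'a set \<Rightarrow> ('a, 'b) monoid_scheme \<Rightarrow> bool" where
  "maximal_subgroup M G \<longleftrightarrow>
     subgroup M G \<and> M \<noteq> carrier G \<and>
     (\<forall>K. subgroup K G \<and> M \<subseteq> K \<longrightarrow> K = M \<or> K = carrier G)"

definition core :: "('a, 'b) monoid_scheme \<Rightarrow> 'a set \<Rightarrow> 'a set" where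
  "core G H = (\<Inter>g\<in>carrier G. g <#\<^bsub>G\<^esub> H #>\<^bsub>G\<^esub> inv\<^bsub>G\<^esub> g)"

definition F_subnormal :: "nat monoid set \<Rightarrow> 'a set \<Rightarrow> ('a, 'b) monoid_scheme \<Rightarrow> bool" where
  "F_subnormal \<FF> H G \<longleftrightarrow>
     subgroup H G \<and>
     (H = carrier G \<or>
      (\<exists>(n :: nat) C. C 0 = H \<and> C n = carrier G \<and>
         (\<forall>i\<le>n. subgroup (C i) G) \<and>
         (\<forall>i\<in>{1..n}.
            maximal_subgroup (C (i - 1)) (G\<lparr>carrier := C i\<rparr>) \<and>
            in_class (G\<lparr>carrier := C i\<rparr> Mod core (G\<lparr>carrier := C i\<rparr>) (C (i - 1))) \<FF>)))"

definition F_subnormalizer ::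
  "nat monoid set \<Rightarrow> ('a, 'b) monoid_scheme \<Rightarrow> 'a set \<Rightarrow> 'a set \<Rightarrow> bool" where
  "F_subnormalizer \<FF> G H T \<longleftrightarrow>
     subgroup T G \<and> F_subnormal \<FF> H (G\<lparr>carrier := T\<rparr>) \<and>
     (\<forall>M. subgroup M G \<and> T \<subseteq> M \<and> F_subnormal \<FF> H (G\<lparr>carrier := M\<rparr>) \<longrightarrow> T = M)"

(* Intersecting with the carrier makes the empty intersection equal to the whole group. *)
definition SI :: "('a monoid \<Rightarrow> 'a set set) \<Rightarrow> nat monoid set \<Rightarrow> 'a monoid \<Rightarrow> 'a set" where
  "SI \<Sigma> \<FF> G = carrier G \<inter> \<Inter>{T. \<exists>H\<in>\<Sigma> G. F_subnormalizer \<FF> G H T}"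

(* The set product N1 <#> ... <#> Nk of a finite family of normal subgroups. Normal subgroups
   permute, so all enumerations of the family give the same product, and the union over them
   is that common value; see product_of_normal_subgroups_eq. *)
definition product_of_normal_subgroups ::
  "('a, 'b) monoid_scheme \<Rightarrow> 'a set set \<Rightarrow> 'a set" where
  "product_of_normal_subgroups G \<N> =
     (\<Union>Ns\<in>{Ns. distinct Ns \<and> set Ns = \<N>}. foldr (\<lambda>M N. M <#>\<^bsub>G\<^esub> N) Ns {\<one>\<^bsub>G\<^esub>})"

lemma (in group) foldr_set_mult_normal:
  assumes "\<forall>N\<in>set Ns. N \<lhd> G"
  shows "foldr (\<lambda>M N. M <#> N) Ns {\<one>} \<lhd> G \<and>
         foldr (\<lambda>M N. M <#> N) Ns {\<one>} = generate G (\<Union>(set Ns))"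
  using assms
proof (induction Ns)
  case Nil
  then show ?case by (simp add: generate_empty one_is_normal)
next
  case (Cons N Ns)
  let ?P = "foldr (\<lambda>M N. M <#> N) Ns {\<one>}"
  have N: "N \<lhd> G" and P: "?P \<lhd> G" and eq: "?P = generate G (\<Union>(set Ns))"
    using Cons by auto
  have NP: "N <#> ?P \<lhd> G"
    using normal_subgroup_set_mult_closed[OF N P] .
  have sub: "\<Union>(set (N # Ns)) \<subseteq> carrier G"
    using Cons.prems normal_imp_subgroup subgroup.subset by blast
  have "?P \<subseteq> generate G (\<Union>(set (N # Ns)))"
    unfolding eq by (rule mono_generate) auto
  then have "N <#> ?P \<subseteq> generate G (\<Union>(set (N # Ns)))"
    by (auto simp: set_mult_def intro!: generate.eng intro: generate.incl)
  moreover have "generate G (\<Union>(set (N # Ns))) \<subseteq> N <#> ?P"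
  proof (rule generate_subgroup_incl[OF _ normal_imp_subgroup[OF NP]])
    have 1: "\<one> \<in> N" "\<one> \<in> ?P"
      using N P normal_imp_subgroup subgroup.one_closed by blast+
    have 2: "N \<subseteq> carrier G" "?P \<subseteq> carrier G"
      using N P normal_imp_subgroup subgroup.subset by blast+
    have "U \<subseteq> U <#> V \<and> V \<subseteq> U <#> V"
      if "\<one> \<in> U" "\<one> \<in> V" "U \<subseteq> carrier G" "V \<subseteq> carrier G" for U V
      using that unfolding set_mult_def by force
    from this[OF 1 2] have "N \<subseteq> N <#> ?P" "?P \<subseteq> N <#> ?P" by auto
    moreover have "\<Union>(set Ns) \<subseteq> ?P"
      unfolding eq by (auto intro: generate.incl)
    ultimately show "\<Union>(set (N # Ns)) \<subseteq> N <#> ?P" by auto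
  qed
  ultimately show ?case using NP by simp
qed

lemma (in group) product_of_normal_subgroups_eq:
  assumes "\<forall>N\<in>set Ns. N \<lhd> G" "distinct Ns"
  shows "product_of_normal_subgroups G (set Ns) = foldr (\<lambda>M N. M <#> N) Ns {\<one>}"
proof -
  have "foldr (\<lambda>M N. M <#> N) Ms {\<one>} = foldr (\<lambda>M N. M <#> N) Ns {\<one>}"
    if "set Ms = set Ns" for Ms
    using foldr_set_mult_normal[of Ms] foldr_set_mult_normal[of Ns] that assms by simp
  then show ?thesis
    unfolding product_of_normal_subgroups_def using assms(2) by blast
qed

end

theory Submission
  imports Defs
begin

text \<open>
  For a hereditary formation, F-subnormality is insensitive to refining or coarsening the chain:
  it suffices that each term contains a normal subgroup of the next one with quotient in the class.
  In this form the steps are visibly stable under intersection with a subgroup, multiplication by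
  a normal subgroup of G, and isomorphisms.
  Let S be the intersection of all subnormalizers of members of \<open>\<Sigma>(G)\<close>; it is normal because
  inner automorphisms permute these subnormalizers. If H is F-subnormal in HN and T is a subnormalizer
  of H, multiplying a chain from H to T by N shows that H is F-subnormal in TN, so
  \<open>N \<subseteq> T\<close> by maximality of T; thus every N in the family lies in S. Conversely, \<open>HS \<subseteq> T\<close>
  and intersecting a chain from H to T with HS shows that S itself is in the family.
\<close>

section \<open>Transfer of class membership between quotients\<close>

text \<open>Closure under quotients is available only for members of the class itself, so
  \<open>f\<close> is composed with an isomorphism from a representative \<open>P\<close> of
  \<open>A\<close>. The first isomorphism theorem then presents \<open>B\<close> as a quotient of
  \<open>P\<close>.\<close>

lemma in_class_surj_hom:
  assumes "formation \<FF>" "in_class A \<FF>" "group B" "f \<in> hom A B" "f ` carrier A = carrier B"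
  shows "in_class B \<FF>"
proof -
  obtain P where P: "P \<in> \<FF>" "A \<cong> P" and A: "group A"
    using assms(2) by (auto simp: in_class_def)
  have "group P"
    using assms(1) P(1) by (auto simp: formation_def group_class_def finite_group_def)
  obtain j where j: "j \<in> iso P A"
    using group.iso_sym[OF A P(2)] by (auto simp: is_iso_def)
  then have "f \<circ> j \<in> hom P B"
    using assms(4) by (auto simp: iso_def intro: hom_compose)
  then interpret fj: group_hom P B "f \<circ> j"
    using \<open>group P\<close> assms(3) by (simp add: group_hom_def group_hom_axioms_def)
  have "(f \<circ> j) ` carrier P = carrier B"
    using j assms(5) by (metis (no_types, lifting) bij_betw_def image_comp iso_def mem_Collect_eq)
  then have "P Mod kernel P B (f \<circ> j) \<cong> B"
    by (rule is_isoI[OF fj.FactGroup_iso_set])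
  moreover have "in_class (P Mod kernel P B (f \<circ> j)) \<FF>"
    using assms(1) P(1) fj.normal_kernel by (auto simp: formation_def)
  ultimately show ?thesis
    using assms(3) unfolding in_class_def by (meson group.iso_sym iso_trans)
qed

text \<open>Since \<open>f\<close> kills \<open>D\<close>, it factors through
  \<open>K Mod D\<close>, and the induced map is still onto \<open>B\<close>.\<close>

lemma in_class_Mod_surj_hom:
  assumes "formation \<FF>" "D \<lhd> K" "in_class (K Mod D) \<FF>"
    and "group B" "f \<in> hom K B" "f ` carrier K = carrier B" "D \<subseteq> kernel K B f"
  shows "in_class B \<FF>"
proof -
  interpret f: group_hom K B f
    using assms by (simp add: group_hom_def group_hom_axioms_def normal_def)
  obtain g where g: "g \<in> hom (K Mod D) B" "\<And>x. x \<in> carrier K \<Longrightarrow> g (D #>\<^bsub>K\<^esub> x) = f x"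
    using f.FactGroup_universal_kernel[OF assms(2,7)] by blast
  then have "g ` carrier (K Mod D) = carrier B"
    using assms(6) by (simp add: carrier_FactGroup image_image)
  then show ?thesis
    using in_class_surj_hom[OF assms(1,3,4) g(1)] by simp
qed

text \<open>The quotient by the kernel is isomorphic to the image. Pushing this image into a
  representative \<open>P\<close> of \<open>A\<close> makes it a subgroup of a member of the class,
  where heredity applies.\<close>

lemma in_class_Mod_kernel:
  assumes "group_class \<FF>" "hereditary \<FF>" "in_class A \<FF>" "group B" "f \<in> hom B A"
  shows "in_class (B Mod kernel B A f) \<FF>"
proof -
  obtain P i where P: "P \<in> \<FF>" and i: "i \<in> iso A P" and A: "group A"
    using assms(3) by (auto simp: in_class_def is_iso_def)
  have "group P"
    using assms(1) P(1) by (auto simp: group_class_def finite_group_def)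
  interpret i: group_hom A P i
    using A \<open>group P\<close> i by (simp add: group_hom_def group_hom_axioms_def iso_def)
  have "i \<circ> f \<in> hom B P"
    using assms(5) i by (auto simp: iso_def intro: hom_compose)
  then interpret g: group_hom B P "i \<circ> f"
    using \<open>group P\<close> assms(4) by (simp add: group_hom_def group_hom_axioms_def)
  let ?Q = "P\<lparr>carrier := (i \<circ> f) ` carrier B\<rparr>"
  have Q: "?Q \<in> \<FF>"
    using assms(2) P g.img_is_subgroup by (auto simp: hereditary_def)
  interpret h: group_hom B ?Q "i \<circ> f"
    using g.induced_group_hom[OF g.G.subgroup_self] by simp
  \<comment> \<open>Injectivity of \<open>i\<close> ensures that passing to the representative
    leaves the kernel unchanged.\<close>
  have "i (f x) = \<one>\<^bsub>P\<^esub> \<longleftrightarrow> f x = \<one>\<^bsub>A\<^esub>" if "x \<in> carrier B" for x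
    using i hom_in_carrier[OF assms(5) that] i.hom_one
    by (metis (no_types, lifting) bij_betw_def i.G.one_closed inj_onD iso_def mem_Collect_eq)
  then have "kernel B ?Q (i \<circ> f) = kernel B A f"
    by (auto simp: kernel_def)
  then have "B Mod kernel B A f \<cong> ?Q"
    using is_isoI[OF h.FactGroup_iso_set] by simp
  moreover have "group (B Mod kernel B A f)"
    using \<open>kernel B ?Q (i \<circ> f) = kernel B A f\<close> h.normal_kernel normal.factorgroup_is_group by metis
  ultimately show ?thesis
    using Q by (auto simp: in_class_def)
qed

text \<open>The composite of \<open>f\<close> with the projection to \<open>L Mod E\<close> kills
  \<open>D\<close>, and \<open>rep\<close> makes it onto: each coset of \<open>E\<close> meets the
  image of \<open>f\<close>. This is used with inclusions, with restricted isomorphisms, and with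
  the identity when \<open>D\<close> is enlarged.\<close>

lemma in_class_Mod_hom:
  assumes "formation \<FF>" "D \<lhd> K" "in_class (K Mod D) \<FF>" "E \<lhd> L" "f \<in> hom K L" "f ` D \<subseteq> E"
    and rep: "\<And>y. y \<in> carrier L \<Longrightarrow> \<exists>x\<in>carrier K. y \<in> E #>\<^bsub>L\<^esub> f x"
  shows "in_class (L Mod E) \<FF>"
proof (rule in_class_Mod_surj_hom[OF assms(1-3)])
  interpret E: normal E L by fact
  let ?q = "\<lambda>y. E #>\<^bsub>L\<^esub> y"
  show "group (L Mod E)" by (rule E.factorgroup_is_group)
  show "?q \<circ> f \<in> hom K (L Mod E)"
    by (rule hom_compose[OF assms(5) E.r_coset_hom_Mod])
  have f: "f x \<in> carrier L" if "x \<in> carrier K" for x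
    using that assms(5) by (rule hom_in_carrier[rotated])
  have "?q y \<in> (?q \<circ> f) ` carrier K" if y: "y \<in> carrier L" for y
  proof -
    obtain x where "x \<in> carrier K" "y \<in> ?q (f x)" using rep[OF y] by blast
    moreover from this have "?q (f x) = ?q y"
      using E.repr_independence f E.subgroup_axioms by blast
    ultimately show ?thesis by (metis comp_apply image_eqI)
  qed
  then show "(?q \<circ> f) ` carrier K = carrier (L Mod E)"
    using f by (auto simp: carrier_FactGroup)
  have "?q (f d) = E" if "d \<in> D" for d
    using that assms(6) E.rcos_const by auto
  then show "D \<subseteq> kernel K (L Mod E) (?q \<circ> f)"
    using normal_imp_subgroup[OF assms(2)] by (auto simp: kernel_def dest: subgroup.mem_carrier)
qed

section \<open>Chains as paths of a step relation\<close>

text \<open>All terms live in one ambient group \<open>G\<close>, so that chains ending in different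
  subgroups can be compared and joined. Equality of \<open>H\<close> and \<open>K\<close> is allowed
  because a proper step may collapse under intersection or multiplication.\<close>

definition F_step :: "nat monoid set \<Rightarrow> ('a, 'b) monoid_scheme \<Rightarrow> 'a set \<Rightarrow> 'a set \<Rightarrow> bool" where
  "F_step \<FF> G H K \<longleftrightarrow> subgroup H G \<and> subgroup K G \<and> H \<subseteq> K \<and>
     (\<exists>D. D \<lhd> G\<lparr>carrier := K\<rparr> \<and> D \<subseteq> H \<and> in_class (G\<lparr>carrier := K\<rparr> Mod D) \<FF>)"

definition F_max_step :: "nat monoid set \<Rightarrow> ('a, 'b) monoid_scheme \<Rightarrow> 'a set \<Rightarrow> 'a set \<Rightarrow> bool" where
  "F_max_step \<FF> G M L \<longleftrightarrow> subgroup M G \<and> subgroup L G \<and>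
     maximal_subgroup M (G\<lparr>carrier := L\<rparr>) \<and>
     in_class (G\<lparr>carrier := L\<rparr> Mod core (G\<lparr>carrier := L\<rparr>) M) \<FF>"

text \<open>Lets an operation on subgroups act on all terms of a chain at once.\<close>

lemma rtranclp_image:
  assumes "R\<^sup>*\<^sup>* x y" "\<And>x y. R x y \<Longrightarrow> S (f x) (f y)"
  shows "S\<^sup>*\<^sup>* (f x) (f y)"
  using assms(1) by induction (auto intro: rtranclp.rtrancl_into_rtrancl assms(2))

text \<open>The separate case where \<open>H\<close> is the whole group is a chain of length 0, and
  the links are reindexed to start at 0, which is the form used for relation powers.\<close>

lemma F_subnormal_iff_chain:
  "F_subnormal \<FF> H G \<longleftrightarrow> subgroup H G \<and>
     (\<exists>n C. C 0 = H \<and> C n = carrier G \<and> (\<forall>i\<le>n. subgroup (C i) G) \<and>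
        (\<forall>i<n. maximal_subgroup (C i) (G\<lparr>carrier := C (Suc i)\<rparr>) \<and>
          in_class (G\<lparr>carrier := C (Suc i)\<rparr> Mod core (G\<lparr>carrier := C (Suc i)\<rparr>) (C i)) \<FF>))"
    (is "_ \<longleftrightarrow> _ \<and> ?P")
proof -
  have shift: "(\<forall>i\<in>{1..n}. R i) \<longleftrightarrow> (\<forall>i<n. R (Suc i))" for n :: nat and R
    unfolding image_Suc_lessThan[symmetric] by auto
  have absorb: "A \<and> (B \<or> C) \<longleftrightarrow> A \<and> C" if "A \<Longrightarrow> B \<Longrightarrow> C" for A B C
    using that by blast
  show ?thesis
    unfolding F_subnormal_def shift diff_Suc_1
    by (rule absorb) (intro exI[of _ 0] exI[of _ "\<lambda>_. H"], simp)
qed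

context group
begin

section \<open>Conjugation, products with normal subgroups, and cores\<close>

lemma inv_mult_cancel:
  assumes "x \<in> carrier G" "y \<in> carrier G"
  shows "x \<otimes> (inv x \<otimes> y) = y" "inv x \<otimes> (x \<otimes> y) = y"
  using assms by (simp_all add: m_assoc[symmetric])

lemma normal_mem_conj:
  assumes "N \<lhd> G" "x \<in> carrier G" "h \<in> N"
  shows "x \<otimes> h \<otimes> inv x \<in> N" "inv x \<otimes> h \<otimes> x \<in> N"
  using assms by (auto simp: normal.inv_op_closed1 normal.inv_op_closed2)

lemma subgroup_set_mult_normal:
  assumes "subgroup H G" "N \<lhd> G"
  shows "subgroup (H <#> N) G" "H \<subseteq> H <#> N" "N \<subseteq> H <#> N"
proof -
  interpret N: normal N G by fact
  interpret S: second_isomorphism_grp N G H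
    by (simp add: second_isomorphism_grp_def second_isomorphism_grp_axioms_def assms)
  show "subgroup (H <#> N) G" "H \<subseteq> H <#> N" "N \<subseteq> H <#> N"
    using S.normal_set_mult_subgroup S.S_contained_in_set_mult S.H_contained_in_set_mult
    by (simp_all add: commut_normal[OF assms])
qed

lemma core_normal:
  assumes "subgroup H G"
  shows "core G H \<lhd> G" "core G H \<subseteq> H"
proof -
  \<comment> \<open>Membership in the core means that all conjugates lie in \<open>H\<close>; this
    reduces the subgroup axioms of the core to those of \<open>H\<close>.\<close>
  have memb: "x \<in> core G H \<longleftrightarrow> x \<in> carrier G \<and> (\<forall>g\<in>carrier G. inv g \<otimes> x \<otimes> g \<in> H)" for x
  proof -
    have "x \<in> g <# H #> inv g \<longleftrightarrow> x \<in> carrier G \<and> inv g \<otimes> x \<otimes> g \<in> H" if g: "g \<in> carrier G" for g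
    proof
      assume "x \<in> g <# H #> inv g"
      then obtain h where h: "h \<in> H" "x = g \<otimes> h \<otimes> inv g"
        by (auto simp: l_coset_def r_coset_def)
      have "h \<in> carrier G" by (rule subgroup.mem_carrier[OF assms h(1)])
      then show "x \<in> carrier G \<and> inv g \<otimes> x \<otimes> g \<in> H"
        using h g by (simp add: m_assoc inv_mult_cancel)
    next
      assume x: "x \<in> carrier G \<and> inv g \<otimes> x \<otimes> g \<in> H"
      then have "x = g \<otimes> (inv g \<otimes> x \<otimes> g) \<otimes> inv g"
        using g by (simp add: m_assoc inv_mult_cancel)
      then show "x \<in> g <# H #> inv g"
        using x by (auto simp: l_coset_def r_coset_def)
    qed
    then show ?thesis unfolding core_def using one_closed by blast
  qed
  show sub: "core G H \<subseteq> H"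
    using memb by force
  interpret H: subgroup H G by fact
  show "core G H \<lhd> G"
  proof (rule normal_invI)
    show "subgroup (core G H) G"
    proof (rule subgroupI)
      show "core G H \<subseteq> carrier G" using memb by blast
      have "\<one> \<in> core G H" by (simp add: memb)
      then show "core G H \<noteq> {}" by blast
    next
      fix a assume a: "a \<in> core G H"
      have "inv g \<otimes> inv a \<otimes> g \<in> H" if g: "g \<in> carrier G" for g
      proof -
        have "inv (inv g \<otimes> a \<otimes> g) \<in> H" using a g memb H.m_inv_closed by blast
        then show ?thesis using a g memb by (simp add: inv_mult_group m_assoc)
      qed
      then show "inv a \<in> core G H" using a memb by simp
    next
      fix a b assume a: "a \<in> core G H" and b: "b \<in> core G H"
      have "inv g \<otimes> (a \<otimes> b) \<otimes> g \<in> H" if g: "g \<in> carrier G" for g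
      proof -
        have "(inv g \<otimes> a \<otimes> g) \<otimes> (inv g \<otimes> b \<otimes> g) \<in> H" using a b g memb H.m_closed by blast
        moreover have "(inv g \<otimes> a \<otimes> g) \<otimes> (inv g \<otimes> b \<otimes> g) = inv g \<otimes> (a \<otimes> b) \<otimes> g"
          using a b g memb by (simp add: m_assoc inv_mult_cancel)
        ultimately show ?thesis by simp
      qed
      then show "a \<otimes> b \<in> core G H" using a b memb by simp
    qed
  next
    fix x h assume x: "x \<in> carrier G" and h: "h \<in> core G H"
    have "inv g \<otimes> (x \<otimes> h \<otimes> inv x) \<otimes> g \<in> H" if g: "g \<in> carrier G" for g
    proof -
      \<comment> \<open>Conjugating by \<open>x\<close> only reparametrises the condition:
        \<open>g\<close> is replaced by \<open>inv x \<otimes> g\<close>, which again ranges over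
        the group.\<close>
      have "inv (inv x \<otimes> g) \<otimes> h \<otimes> (inv x \<otimes> g) \<in> H" using h x g memb by blast
      then show ?thesis using h x g memb by (simp add: inv_mult_group m_assoc)
    qed
    then show "x \<otimes> h \<otimes> inv x \<in> core G H" using x h memb by simp
  qed
qed

lemma normal_subset_core:
  assumes "D \<lhd> G" "D \<subseteq> H"
  shows "D \<subseteq> core G H"
proof
  fix d assume d: "d \<in> D"
  have dG: "d \<in> carrier G"
    using d normal_imp_subgroup[OF assms(1)] by (auto dest: subgroup.mem_carrier)
  have "d \<in> g <# H #> inv g" if g: "g \<in> carrier G" for g
  proof -
    have "inv g \<otimes> d \<otimes> g \<in> H" using normal_mem_conj(2)[OF assms(1) g d] assms(2) by blast
    moreover have "d = g \<otimes> (inv g \<otimes> d \<otimes> g) \<otimes> inv g"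
      using g dG by (simp add: m_assoc inv_mult_cancel)
    ultimately show ?thesis by (auto simp: l_coset_def r_coset_def)
  qed
  then show "d \<in> core G H" by (simp add: core_def)
qed

section \<open>Stability of steps under intersection, multiplication and isomorphism\<close>

text \<open>Restricting the projection of \<open>K\<close> modulo \<open>D\<close> to
  \<open>K \<inter> U\<close> gives a map with kernel \<open>D \<inter> U\<close>, so the new
  quotient embeds in the old one and heredity applies.\<close>

lemma F_step_Int:
  assumes "group_class \<FF>" "hereditary \<FF>" "F_step \<FF> G H K" "subgroup U G"
  shows "F_step \<FF> G (H \<inter> U) (K \<inter> U)"
proof -
  obtain D where HK: "subgroup H G" "subgroup K G" "H \<subseteq> K"
    and D: "D \<lhd> G\<lparr>carrier := K\<rparr>" "D \<subseteq> H" "in_class (G\<lparr>carrier := K\<rparr> Mod D) \<FF>"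
    using assms(3) by (auto simp: F_step_def)
  interpret D: normal D "G\<lparr>carrier := K\<rparr>" by fact
  let ?q = "\<lambda>x. D #>\<^bsub>G\<lparr>carrier := K\<rparr>\<^esub> x"
  let ?L = "G\<lparr>carrier := K \<inter> U\<rparr>"
  have KU: "subgroup (K \<inter> U) G" using HK assms(4) subgroups_Inter_pair by blast
  have "?q \<in> hom ?L (G\<lparr>carrier := K\<rparr> Mod D)"
    using D.r_coset_hom_Mod by (auto simp: hom_def)
  moreover have "?q x = D \<longleftrightarrow> x \<in> D" if "x \<in> K" for x
    using that D.rcos_const D.rcos_self[of x] D.subgroup_axioms by auto
  then have "kernel ?L (G\<lparr>carrier := K\<rparr> Mod D) ?q = D \<inter> U"
    using D(2) HK(3) by (auto simp: kernel_def)
  ultimately have "in_class (?L Mod (D \<inter> U)) \<FF>"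
    using in_class_Mod_kernel[OF assms(1,2) D(3) subgroup_imp_group[OF KU]] by metis
  moreover have "D \<inter> U \<lhd> ?L" using normal_inter[OF HK(2) assms(4) D(1)] .
  ultimately show ?thesis
    using HK D KU subgroups_Inter_pair[OF HK(1) assms(4)] by (auto simp: F_step_def)
qed

lemma normal_set_mult:
  assumes "subgroup K G" "D \<lhd> G\<lparr>carrier := K\<rparr>" "N \<lhd> G"
  shows "D <#> N \<lhd> G\<lparr>carrier := K <#> N\<rparr>"
proof -
  have D: "subgroup D G" "D \<subseteq> K"
    using normal_imp_subgroup[OF assms(2)] incl_subgroup[OF assms(1)] subgroup.subset by force+
  have N: "subgroup N G" using assms(3) normal_imp_subgroup by blast
  note KN = subgroup_set_mult_normal[OF assms(1,3)] and DN = subgroup_set_mult_normal[OF D(1) assms(3)]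
  interpret L: group "G\<lparr>carrier := K <#> N\<rparr>" using subgroup_imp_group[OF KN(1)] .
  note [simp] = subgroup.mem_carrier[OF assms(1)] subgroup.mem_carrier[OF D(1)] subgroup.mem_carrier[OF N]
  show ?thesis
  proof (rule L.normal_invI)
    show "subgroup (D <#> N) (G\<lparr>carrier := K <#> N\<rparr>)"
      using subgroup_incl[OF DN(1) KN(1)] D(2) by (auto simp: set_mult_def)
  next
    fix x h assume x: "x \<in> carrier (G\<lparr>carrier := K <#> N\<rparr>)" and h: "h \<in> D <#> N"
    obtain k n where kn: "k \<in> K" "n \<in> N" "x = k \<otimes> n" using x by (auto simp: set_mult_def)
    obtain d m where dm: "d \<in> D" "m \<in> N" "h = d \<otimes> m" using h by (auto simp: set_mult_def)
    \<comment> \<open>Moving \<open>n\<close> past \<open>d\<close> gives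
      \<open>n \<otimes> d \<otimes> m \<otimes> inv n = d \<otimes> a\<close>; normality of
      \<open>N\<close> keeps the correction \<open>a\<close> in \<open>N\<close>.\<close>
    define a where "a = (inv d \<otimes> n \<otimes> d) \<otimes> m \<otimes> inv n"
    have "inv d \<otimes> n \<otimes> d \<in> N" using normal_mem_conj(2)[OF assms(3)] kn dm by simp
    then have a: "a \<in> N" unfolding a_def using dm kn N by (meson subgroup.m_closed subgroup.m_inv_closed)
    have "k \<otimes> d \<otimes> inv k \<in> D"
      using group.normal_mem_conj(1)[OF subgroup_imp_group[OF assms(1)] assms(2), of k d] kn dm assms(1)
      by simp
    moreover have "k \<otimes> a \<otimes> inv k \<in> N" using normal_mem_conj(1)[OF assms(3)] kn a by simp
    moreover have "x \<otimes> h \<otimes> inv x = (k \<otimes> d \<otimes> inv k) \<otimes> (k \<otimes> a \<otimes> inv k)"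
      using kn dm by (simp add: a_def m_assoc inv_mult_group inv_mult_cancel)
    ultimately have "x \<otimes> h \<otimes> inv x \<in> D <#> N" by (auto simp: set_mult_def)
    then show "x \<otimes>\<^bsub>G\<lparr>carrier := K <#> N\<rparr>\<^esub> h \<otimes>\<^bsub>G\<lparr>carrier := K <#> N\<rparr>\<^esub> inv\<^bsub>G\<lparr>carrier := K <#> N\<rparr>\<^esub> x \<in> D <#> N"
      using x KN(1) by simp
  qed
qed

text \<open>Every coset of \<open>D <#> N\<close> in \<open>K <#> N\<close> meets \<open>K\<close>,
  so the new quotient is an image of \<open>K\<close> modulo \<open>D\<close> under the map induced
  by inclusion.\<close>

lemma F_step_set_mult:
  assumes "formation \<FF>" "F_step \<FF> G H K" "N \<lhd> G"
  shows "F_step \<FF> G (H <#> N) (K <#> N)"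
proof -
  obtain D where HK: "subgroup H G" "subgroup K G" "H \<subseteq> K"
    and D: "D \<lhd> G\<lparr>carrier := K\<rparr>" "D \<subseteq> H" "in_class (G\<lparr>carrier := K\<rparr> Mod D) \<FF>"
    using assms(2) by (auto simp: F_step_def)
  have D': "subgroup D G"
    using normal_imp_subgroup[OF D(1)] incl_subgroup[OF HK(2)] by blast
  note KN = subgroup_set_mult_normal[OF HK(2) assms(3)]
    and HN = subgroup_set_mult_normal[OF HK(1) assms(3)]
    and DN = subgroup_set_mult_normal[OF D' assms(3)]
  have "in_class (G\<lparr>carrier := K <#> N\<rparr> Mod (D <#> N)) \<FF>"
  proof (rule in_class_Mod_hom[OF assms(1) D(1,3) normal_set_mult[OF HK(2) D(1) assms(3)]])
    show "id \<in> hom (G\<lparr>carrier := K\<rparr>) (G\<lparr>carrier := K <#> N\<rparr>)"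
      using KN(2) by (auto simp: hom_def)
    show "id ` D \<subseteq> D <#> N" using DN(2) by simp
    fix y assume "y \<in> carrier (G\<lparr>carrier := K <#> N\<rparr>)"
    then obtain k n where kn: "k \<in> K" "n \<in> N" "y = k \<otimes> n" by (auto simp: set_mult_def)
    have carr: "k \<in> carrier G" "n \<in> carrier G"
      using subgroup.mem_carrier[OF HK(2) kn(1)] subgroup.mem_carrier[OF normal_imp_subgroup[OF assms(3)] kn(2)] .
    have "k \<otimes> n \<otimes> inv k \<in> D <#> N"
      using normal_mem_conj(1)[OF assms(3) carr(1) kn(2)] DN(3) by blast
    \<comment> \<open>Right cosets require the factor from \<open>N\<close> on the left, hence the
      conjugate of \<open>n\<close> by \<open>k\<close>.\<close>
    moreover have "y = (k \<otimes> n \<otimes> inv k) \<otimes> k" using kn(3) carr by (simp add: m_assoc)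
    ultimately show "\<exists>x\<in>carrier (G\<lparr>carrier := K\<rparr>). y \<in> (D <#> N) #>\<^bsub>G\<lparr>carrier := K <#> N\<rparr>\<^esub> id x"
      using kn(1) by (auto simp: r_coset_def)
  qed
  moreover have "D <#> N \<subseteq> H <#> N" "H <#> N \<subseteq> K <#> N"
    using D(2) HK(3) by (auto simp: set_mult_def)
  ultimately show ?thesis
    using KN(1) HN(1) normal_set_mult[OF HK(2) D(1) assms(3)] by (auto simp: F_step_def)
qed

lemma F_step_iso:
  assumes "formation \<FF>" "F_step \<FF> G H K" "group G'" "f \<in> iso G G'"
  shows "F_step \<FF> G' (f ` H) (f ` K)"
proof -
  obtain D where HK: "subgroup H G" "subgroup K G" "H \<subseteq> K"
    and D: "D \<lhd> G\<lparr>carrier := K\<rparr>" "D \<subseteq> H" "in_class (G\<lparr>carrier := K\<rparr> Mod D) \<FF>"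
    using assms(2) by (auto simp: F_step_def)
  interpret f: group_hom G G' f
    using assms(3,4) by (simp add: group_hom_def group_hom_axioms_def iso_def)
  interpret g: group_hom "G\<lparr>carrier := K\<rparr>" "G'\<lparr>carrier := f ` K\<rparr>" f
    by (rule f.induced_group_hom[OF HK(2)])
  have D': "f ` D \<lhd> G'\<lparr>carrier := f ` K\<rparr>"
    using normal.surj_hom_normal_subgroup[OF D(1) g.group_hom_axioms] by simp
  have "in_class (G'\<lparr>carrier := f ` K\<rparr> Mod (f ` D)) \<FF>"
    using normal_imp_subgroup[OF D', THEN g.H.rcos_self[rotated]]
    by (intro in_class_Mod_hom[OF assms(1) D(1,3) D' g.homh]) auto
  then show ?thesis
    using HK D D' f.subgroup_img_is_subgroup by (auto simp: F_step_def intro!: exI[of _ "f ` D"])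
qed

section \<open>Equivalence of steps with maximal chains\<close>

text \<open>The core itself serves as the normal subgroup \<open>D\<close>.\<close>

lemma F_max_step_imp_F_step:
  assumes "F_max_step \<FF> G M L"
  shows "F_step \<FF> G M L"
proof -
  have M: "subgroup M (G\<lparr>carrier := L\<rparr>)" "subgroup L G"
    using assms by (auto simp: F_max_step_def maximal_subgroup_def)
  show ?thesis
    using assms subgroup.subset[OF M(1)] group.core_normal[OF subgroup_imp_group[OF M(2)] M(1)]
    by (auto simp: F_max_step_def F_step_def)
qed

text \<open>The core is the largest normal subgroup of \<open>L\<close> inside \<open>M\<close>, so
  it contains \<open>D\<close>, and the quotient by it is an image of the quotient by
  \<open>D\<close>.\<close>

lemma F_max_stepI:
  assumes "formation \<FF>" "F_step \<FF> G M L" "maximal_subgroup M (G\<lparr>carrier := L\<rparr>)"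
  shows "F_max_step \<FF> G M L"
proof -
  let ?L = "G\<lparr>carrier := L\<rparr>"
  obtain D where sub: "subgroup M G" "subgroup L G"
    and D: "D \<lhd> ?L" "D \<subseteq> M" "in_class (?L Mod D) \<FF>"
    using assms(2) by (auto simp: F_step_def)
  interpret L: group ?L by (rule subgroup_imp_group[OF sub(2)])
  have subM: "subgroup M ?L" using assms(3) by (simp add: maximal_subgroup_def)
  have "y \<in> core ?L M #>\<^bsub>?L\<^esub> id y" if "y \<in> carrier ?L" for y
    using L.rcos_self[OF that normal_imp_subgroup[OF L.core_normal(1)[OF subM]]] by simp
  then have "in_class (?L Mod core ?L M) \<FF>"
    using L.normal_subset_core[OF D(1,2)]
    by (intro in_class_Mod_hom[OF assms(1) D(1,3) L.core_normal(1)[OF subM], of id]) (auto simp: hom_def)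
  then show ?thesis using sub assms(3) by (simp add: F_max_step_def)
qed

text \<open>Induction on the order of \<open>L\<close>: a maximal subgroup \<open>M\<close> of
  \<open>L\<close> above \<open>K\<close> also contains \<open>D\<close>, so the top link from
  \<open>M\<close> to \<open>L\<close> is admissible, and the rest from \<open>K\<close> to
  \<open>M\<close> is a step in a smaller group.\<close>

lemma F_step_imp_rtranclp_F_max_step:
  assumes "formation \<FF>" "hereditary \<FF>" "finite (carrier G)" "F_step \<FF> G K L"
  shows "(F_max_step \<FF> G)\<^sup>*\<^sup>* K L"
  using assms(4)
proof (induction "card L" arbitrary: L rule: less_induct)
  case less
  obtain D where KL: "subgroup K G" "subgroup L G" "K \<subseteq> L"
    and D: "D \<lhd> G\<lparr>carrier := L\<rparr>" "D \<subseteq> K" "in_class (G\<lparr>carrier := L\<rparr> Mod D) \<FF>"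
    using less.prems by (auto simp: F_step_def)
  have fin: "finite L" using KL(2) assms(3) finite_subset subgroup.subset by blast
  show ?case
  proof (cases "K = L")
    case False
    let ?A = "{M. subgroup M G \<and> K \<subseteq> M \<and> M \<subset> L}"
    have "finite ?A" by (rule finite_subset[of _ "Pow L"]) (use fin in auto)
    moreover have "K \<in> ?A" using KL False by auto
    ultimately obtain M where M: "M \<in> ?A" "K \<subseteq> M" and maxi: "\<And>N. N \<in> ?A \<Longrightarrow> M \<subseteq> N \<Longrightarrow> M = N"
      by (metis (no_types, lifting) finite_has_maximal2)
    have "N = M \<or> N = L" if "subgroup N (G\<lparr>carrier := L\<rparr>)" "M \<subseteq> N" for N
      using maxi[of N] that incl_subgroup[OF KL(2) that(1)] subgroup.subset[OF that(1)] M by auto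
    then have maxM: "maximal_subgroup M (G\<lparr>carrier := L\<rparr>)"
      using M subgroup_incl[OF _ KL(2), of M] by (auto simp: maximal_subgroup_def)
    have "F_step \<FF> G M L"
      using M KL D by (auto simp: F_step_def)
    then have sub: "F_max_step \<FF> G M L"
      using F_max_stepI[OF assms(1)] maxM by blast
    have "(F_max_step \<FF> G)\<^sup>*\<^sup>* K M"
    proof (rule less.hyps)
      show "card M < card L" using M fin by (auto intro: psubset_card_mono)
      \<comment> \<open>Intersect the given step with \<open>M\<close>: \<open>K\<close> is
        unchanged and \<open>L\<close> becomes \<open>M\<close>.\<close>
      show "F_step \<FF> G K M"
        using F_step_Int[OF _ assms(2) less.prems, of M] assms(1) M KL(3)
        by (auto simp: formation_def Int_absorb1 Int_absorb2 psubset_eq)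
    qed
    with sub show ?thesis by simp
  qed simp
qed

text \<open>Forwards, each maximal link is a step; backwards, each step is refined into maximal
  links. The result replaces F-subnormality in \<open>T\<close> by reachability inside
  \<open>G\<close>.\<close>

lemma F_subnormal_iff_F_step:
  assumes "formation \<FF>" "hereditary \<FF>" "finite (carrier G)" "subgroup T G"
  shows "F_subnormal \<FF> H (G\<lparr>carrier := T\<rparr>) \<longleftrightarrow> subgroup H G \<and> (F_step \<FF> G)\<^sup>*\<^sup>* H T"
proof
  assume L: "F_subnormal \<FF> H (G\<lparr>carrier := T\<rparr>)"
  then obtain n C where C: "C 0 = H" "C n = T" "\<And>i. i \<le> n \<Longrightarrow> subgroup (C i) G"
    and max: "\<And>i. i < n \<Longrightarrow> maximal_subgroup (C i) (G\<lparr>carrier := C (Suc i)\<rparr>) \<and>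
      in_class (G\<lparr>carrier := C (Suc i)\<rparr> Mod core (G\<lparr>carrier := C (Suc i)\<rparr>) (C i)) \<FF>"
    using incl_subgroup[OF assms(4)] by (auto simp: F_subnormal_iff_chain)
  have "F_step \<FF> G (C i) (C (Suc i))" if "i < n" for i
    using that C(3) max by (intro F_max_step_imp_F_step) (simp add: F_max_step_def)
  then have "(F_step \<FF> G ^^ n) H T"
    using C(1,2) by (auto simp: relpowp_fun_conv)
  moreover have "subgroup H G" using C(1) C(3)[of 0] by simp
  ultimately show "subgroup H G \<and> (F_step \<FF> G)\<^sup>*\<^sup>* H T"
    by (auto simp: rtranclp_power)
next
  assume R: "subgroup H G \<and> (F_step \<FF> G)\<^sup>*\<^sup>* H T"
  then have "(F_step \<FF> G)\<^sup>*\<^sup>* H T" by simp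
  then have "(F_max_step \<FF> G)\<^sup>*\<^sup>* H T"
    by induction (auto dest: F_step_imp_rtranclp_F_max_step[OF assms(1-3)])
  then obtain n C where C: "C 0 = H" "C n = T"
    and chain: "\<And>i. i < n \<Longrightarrow> F_max_step \<FF> G (C i) (C (Suc i))"
    by (auto simp: rtranclp_power relpowp_fun_conv)
  \<comment> \<open>The links only provide subgroups of \<open>G\<close>; containment in
    \<open>T\<close> is obtained by descending from the top term \<open>C n = T\<close>.\<close>
  have sub: "subgroup (C i) (G\<lparr>carrier := T\<rparr>)" if "i \<le> n" for i
    using that
  proof (induction rule: inc_induct)
    case base
    then show ?case using C(2) subgroup_incl[OF assms(4,4)] by simp
  next
    case (step i)
    then have "C (Suc i) \<subseteq> T" using subgroup.subset by fastforce
    moreover have "subgroup (C i) G" "C i \<subseteq> C (Suc i)"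
      using F_max_step_imp_F_step[OF chain[OF \<open>i < n\<close>]]
      by (auto simp: F_step_def)
    ultimately show ?case using subgroup_incl[OF _ assms(4)] by blast
  qed
  then have "subgroup H (G\<lparr>carrier := T\<rparr>)" using C(1) by blast
  moreover have "maximal_subgroup (C i) (G\<lparr>carrier := C (Suc i)\<rparr>) \<and>
      in_class (G\<lparr>carrier := C (Suc i)\<rparr> Mod core (G\<lparr>carrier := C (Suc i)\<rparr>) (C i)) \<FF>" if "i < n" for i
    using chain[OF that] by (simp add: F_max_step_def)
  ultimately show "F_subnormal \<FF> H (G\<lparr>carrier := T\<rparr>)"
    using C sub by (auto simp: F_subnormal_iff_chain)
qed

section \<open>Permanence properties of F-subnormality\<close>

text \<open>Intersecting every term of the chain with \<open>U\<close> fixes the bottom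
  \<open>H\<close> and turns the top \<open>T\<close> into \<open>U\<close>.\<close>

lemma F_subnormal_Int:
  assumes "formation \<FF>" "hereditary \<FF>" "finite (carrier G)"
    and "subgroup T G" "F_subnormal \<FF> H (G\<lparr>carrier := T\<rparr>)"
    and "subgroup U G" "H \<subseteq> U" "U \<subseteq> T"
  shows "F_subnormal \<FF> H (G\<lparr>carrier := U\<rparr>)"
proof -
  have cls: "group_class \<FF>" using assms(1) by (simp add: formation_def)
  have "subgroup H G" "(F_step \<FF> G)\<^sup>*\<^sup>* H T"
    using assms(5) by (simp_all add: F_subnormal_iff_F_step[OF assms(1-4)])
  moreover from this(2) have "(F_step \<FF> G)\<^sup>*\<^sup>* (H \<inter> U) (T \<inter> U)"
    by (rule rtranclp_image) (rule F_step_Int[OF cls assms(2) _ assms(6)])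
  ultimately show ?thesis
    using assms(7,8) by (simp add: F_subnormal_iff_F_step[OF assms(1-3,6)] Int_absorb1 Int_absorb2)
qed

text \<open>Two chains are joined at \<open>H <#> N\<close>: the assumed one from \<open>H\<close>,
  and the product with \<open>N\<close> of the chain from \<open>H\<close> to
  \<open>T\<close>.\<close>

lemma F_subnormal_set_mult:
  assumes "formation \<FF>" "hereditary \<FF>" "finite (carrier G)"
    and "subgroup T G" "F_subnormal \<FF> H (G\<lparr>carrier := T\<rparr>)"
    and "N \<lhd> G" "F_subnormal \<FF> H (G\<lparr>carrier := H <#> N\<rparr>)"
  shows "F_subnormal \<FF> H (G\<lparr>carrier := T <#> N\<rparr>)"
proof -
  have H: "subgroup H G" "(F_step \<FF> G)\<^sup>*\<^sup>* H T"
    using assms(5) by (simp_all add: F_subnormal_iff_F_step[OF assms(1-4)])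
  note HN = subgroup_set_mult_normal(1)[OF H(1) assms(6)]
    and TN = subgroup_set_mult_normal(1)[OF assms(4,6)]
  have "(F_step \<FF> G)\<^sup>*\<^sup>* (H <#> N) (T <#> N)"
    using H(2) by (rule rtranclp_image) (rule F_step_set_mult[OF assms(1) _ assms(6)])
  moreover have "(F_step \<FF> G)\<^sup>*\<^sup>* H (H <#> N)"
    using assms(7) by (simp add: F_subnormal_iff_F_step[OF assms(1-3) HN])
  ultimately show ?thesis
    using H(1) by (simp add: F_subnormal_iff_F_step[OF assms(1-3) TN])
qed

lemma F_subnormal_iso:
  assumes "formation \<FF>" "hereditary \<FF>" "finite (carrier G)"
    and "subgroup T G" "F_subnormal \<FF> H (G\<lparr>carrier := T\<rparr>)"
    and "group G'" "f \<in> iso G G'"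
  shows "F_subnormal \<FF> (f ` H) (G'\<lparr>carrier := f ` T\<rparr>)"
proof -
  interpret f: group_hom G G' f
    using assms(6,7) by (simp add: group_hom_def group_hom_axioms_def iso_def)
  have "f ` carrier G = carrier G'" using assms(7) by (simp add: iso_def bij_betw_def)
  then have fin: "finite (carrier G')" using assms(3) finite_imageI by metis
  have H: "subgroup H G" "(F_step \<FF> G)\<^sup>*\<^sup>* H T"
    using assms(5) by (simp_all add: F_subnormal_iff_F_step[OF assms(1-4)])
  have "(F_step \<FF> G')\<^sup>*\<^sup>* (f ` H) (f ` T)"
    using H(2) by (rule rtranclp_image) (rule F_step_iso[OF assms(1) _ assms(6,7)])
  then show ?thesis
    using H(1) assms(4)
    by (simp add: f.H.F_subnormal_iff_F_step[OF assms(1,2) fin] f.subgroup_img_is_subgroup)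
qed

section \<open>Subnormalizers: transport, existence, normal subgroups below them\<close>

lemma F_subnormalizer_iso:
  assumes "formation \<FF>" "hereditary \<FF>" "finite (carrier G)"
    and "F_subnormalizer \<FF> G H T" "group G'" "f \<in> iso G G'"
  shows "F_subnormalizer \<FF> G' (f ` H) (f ` T)"
proof -
  interpret f: group_hom G G' f
    using assms(5,6) by (simp add: group_hom_def group_hom_axioms_def iso_def)
  let ?g = "inv_into (carrier G) f"
  have g: "?g \<in> iso G' G" by (rule iso_set_sym[OF assms(6)])
  interpret g: group_hom G' G ?g
    using assms(5) g by (simp add: group_hom_def group_hom_axioms_def iso_def)
  have bij: "bij_betw f (carrier G) (carrier G')" using assms(6) by (simp add: iso_def)
  then have "f ` carrier G = carrier G'" by (simp add: bij_betw_def)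
  then have fin: "finite (carrier G')" using assms(3) finite_imageI by metis
  have gf: "?g ` f ` A = A" if "A \<subseteq> carrier G" for A
    using bij that by (simp add: bij_betw_def)
  have fg: "f ` ?g ` A = A" if "A \<subseteq> carrier G'" for A
    using bij that by (metis bij_betw_def image_inv_into_cancel)
  have T: "subgroup T G" "F_subnormal \<FF> H (G\<lparr>carrier := T\<rparr>)"
    and max: "\<And>M. subgroup M G \<Longrightarrow> T \<subseteq> M \<Longrightarrow> F_subnormal \<FF> H (G\<lparr>carrier := M\<rparr>) \<Longrightarrow> T = M"
    using assms(4) by (auto simp: F_subnormalizer_def)
  have H: "H \<subseteq> carrier G"
    using T(2) subgroup.subset by (fastforce simp: F_subnormal_iff_F_step[OF assms(1-3) T(1)])
  have "f ` T = M" if M: "subgroup M G'" "f ` T \<subseteq> M" "F_subnormal \<FF> (f ` H) (G'\<lparr>carrier := M\<rparr>)" for M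
  proof -
    \<comment> \<open>A competitor \<open>M\<close> in \<open>G'\<close> is pulled back along the
      inverse isomorphism, where maximality of \<open>T\<close> decides.\<close>
    have "F_subnormal \<FF> H (G\<lparr>carrier := ?g ` M\<rparr>)"
      using f.H.F_subnormal_iso[OF assms(1,2) fin M(1,3) is_group g] gf[OF H] by simp
    moreover have "T \<subseteq> ?g ` M"
      using image_mono[OF M(2), of ?g] gf[OF subgroup.subset[OF T(1)]] by simp
    ultimately have "T = ?g ` M"
      using max g.subgroup_img_is_subgroup[OF M(1)] by blast
    then show ?thesis using fg[OF subgroup.subset[OF M(1)]] by simp
  qed
  then show ?thesis
    using f.subgroup_img_is_subgroup[OF T(1)] F_subnormal_iso[OF assms(1-3) T assms(5,6)]
    by (auto simp: F_subnormalizer_def)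
qed

lemma conj_iso:
  assumes "g \<in> carrier G"
  shows "(\<lambda>x. g \<otimes> x \<otimes> inv g) \<in> iso G G"
proof -
  have "bij_betw (\<lambda>x. g \<otimes> x \<otimes> inv g) (carrier G) (carrier G)"
    by (rule bij_betwI[where g = "\<lambda>x. inv g \<otimes> x \<otimes> g"])
      (use assms in \<open>simp_all add: m_assoc inv_mult_cancel\<close>)
  then show ?thesis
    using assms by (simp add: iso_def hom_def m_assoc inv_mult_cancel)
qed

text \<open>\<open>H\<close> is F-subnormal in itself, so the finite set of candidates is nonempty
  and has a maximal element.\<close>

lemma F_subnormalizer_exists:
  assumes "finite (carrier G)" "subgroup H G"
  shows "\<exists>T. F_subnormalizer \<FF> G H T"
proof -
  let ?A = "{T. subgroup T G \<and> F_subnormal \<FF> H (G\<lparr>carrier := T\<rparr>)}"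
  have "?A \<subseteq> Pow (carrier G)" using subgroup.subset by blast
  then have "finite ?A" using assms(1) finite_subset by blast
  moreover have "H \<in> ?A"
    using assms(2) subgroup_incl[OF assms(2,2)] by (simp add: F_subnormal_def)
  ultimately obtain T where "T \<in> ?A" "\<And>M. M \<in> ?A \<Longrightarrow> T \<subseteq> M \<Longrightarrow> T = M"
    by (metis (no_types, lifting) finite_has_maximal2)
  then show ?thesis by (auto simp: F_subnormalizer_def)
qed

text \<open>\<open>H\<close> is F-subnormal in \<open>T <#> N\<close>, which contains
  \<open>T\<close>; maximality forces the two to coincide.\<close>

lemma normal_subset_F_subnormalizer:
  assumes "formation \<FF>" "hereditary \<FF>" "finite (carrier G)"
    and "F_subnormalizer \<FF> G H T" "N \<lhd> G" "F_subnormal \<FF> H (G\<lparr>carrier := H <#> N\<rparr>)"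
  shows "N \<subseteq> T"
proof -
  have T: "subgroup T G" "F_subnormal \<FF> H (G\<lparr>carrier := T\<rparr>)"
    using assms(4) by (auto simp: F_subnormalizer_def)
  note TN = subgroup_set_mult_normal[OF T(1) assms(5)]
  have "T = T <#> N"
    using F_subnormal_set_mult[OF assms(1-3) T assms(5,6)] TN assms(4)
    by (auto simp: F_subnormalizer_def)
  then show ?thesis using TN(3) by simp
qed

end

section \<open>The intersection of all subnormalizers\<close>

lemma SI_normal:
  assumes "formation \<FF>" "hereditary \<FF>" "subgroup_functor \<Sigma>" "finite_group G"
  shows "SI \<Sigma> \<FF> G \<lhd> G"
proof -
  interpret group G using assms(4) by (simp add: finite_group_def)
  have fin: "finite (carrier G)" using assms(4) by (simp add: finite_group_def)
  let ?\<T> = "{T. \<exists>H\<in>\<Sigma> G. F_subnormalizer \<FF> G H T}"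
  \<comment> \<open>Inserting the whole group keeps the family nonempty, as the intersection lemma
    for subgroups requires, and gives the right value when there are no subnormalizers.\<close>
  have SI: "SI \<Sigma> \<FF> G = \<Inter>(insert (carrier G) ?\<T>)" by (auto simp: SI_def)
  have "subgroup (\<Inter>(insert (carrier G) ?\<T>)) G"
    by (rule subgroups_Inter) (auto simp: F_subnormalizer_def subgroup_self)
  moreover have "g \<otimes>\<^bsub>G\<^esub> x \<otimes>\<^bsub>G\<^esub> inv\<^bsub>G\<^esub> g \<in> T"
    if g: "g \<in> carrier G" and x: "x \<in> SI \<Sigma> \<FF> G" and T: "T \<in> ?\<T>" for g x T
  proof -
    obtain H where H: "H \<in> \<Sigma> G" "F_subnormalizer \<FF> G H T" using T by blast
    \<comment> \<open>Conjugation by the inverse of \<open>g\<close> is the right choice: membership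
      of \<open>x\<close> in the image of \<open>T\<close> under \<open>?c\<close> says that the
      conjugate of \<open>x\<close> by \<open>g\<close> lies in \<open>T\<close>.\<close>
    let ?c = "\<lambda>x. inv\<^bsub>G\<^esub> g \<otimes>\<^bsub>G\<^esub> x \<otimes>\<^bsub>G\<^esub> inv\<^bsub>G\<^esub> (inv\<^bsub>G\<^esub> g)"
    have c: "?c \<in> iso G G" using g by (intro conj_iso) simp
    have "F_subnormalizer \<FF> G (?c ` H) (?c ` T)"
      by (rule F_subnormalizer_iso[OF assms(1,2) fin H(2) is_group c])
    \<comment> \<open>Functoriality enters here: an automorphism of \<open>G\<close> permutes the
      members of \<open>\<Sigma> G\<close>, so the image of \<open>T\<close> is again one of the
      intersected subgroups.\<close>
    moreover have "(\<lambda>H. ?c ` H) ` \<Sigma> G = \<Sigma> G"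
      using assms(3,4) c unfolding subgroup_functor_def by blast
    then have "?c ` H \<in> \<Sigma> G" using H(1) by blast
    ultimately have "x \<in> ?c ` T" using x by (auto simp: SI_def)
    then obtain t where t: "t \<in> T" "x = ?c t" by blast
    have "t \<in> carrier G" using H(2) t(1) subgroup.subset by (fastforce simp: F_subnormalizer_def)
    then have "g \<otimes>\<^bsub>G\<^esub> x \<otimes>\<^bsub>G\<^esub> inv\<^bsub>G\<^esub> g = t"
      using t(2) g by (simp add: m_assoc inv_mult_cancel)
    then show ?thesis using t(1) by simp
  qed
  ultimately show ?thesis
    by (intro normal_invI) (auto simp: SI_def SI[symmetric] subgroup.mem_carrier)
qed

text \<open>Any one subnormalizer \<open>T\<close> of \<open>H\<close> contains both
  \<open>H\<close> and the intersection, hence their product, and F-subnormality in \<open>T\<close>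
  restricts to that product.\<close>

lemma F_subnormal_set_mult_SI:
  assumes "formation \<FF>" "hereditary \<FF>" "subgroup_functor \<Sigma>" "finite_group G" "H \<in> \<Sigma> G"
  shows "F_subnormal \<FF> H (G\<lparr>carrier := H <#>\<^bsub>G\<^esub> SI \<Sigma> \<FF> G\<rparr>)"
proof -
  interpret group G using assms(4) by (simp add: finite_group_def)
  have fin: "finite (carrier G)" using assms(4) by (simp add: finite_group_def)
  have H: "subgroup H G" using assms(3-5) by (auto simp: subgroup_functor_def)
  note HS = subgroup_set_mult_normal[OF H SI_normal[OF assms(1-4)]]
  obtain T where FT: "F_subnormalizer \<FF> G H T" using F_subnormalizer_exists[OF fin H] by blast
  then have T: "subgroup T G" "F_subnormal \<FF> H (G\<lparr>carrier := T\<rparr>)"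
    by (auto simp: F_subnormalizer_def)
  have "H \<subseteq> T" using subgroup.subset T(2) by (fastforce simp: F_subnormal_def)
  moreover have "SI \<Sigma> \<FF> G \<subseteq> T" using FT assms(5) by (auto simp: SI_def)
  ultimately have "H <#>\<^bsub>G\<^esub> SI \<Sigma> \<FF> G \<subseteq> T"
    using T(1) by (auto simp: set_mult_def intro: subgroup.m_closed)
  then show ?thesis
    by (rule F_subnormal_Int[OF assms(1,2) fin T HS(1,2)])
qed

theorem proposition2:
  fixes \<FF> :: "nat monoid set"
    and \<Sigma> :: "'a monoid \<Rightarrow> 'a set set"
    and G :: "'a monoid"
  assumes "formation \<FF>"
    and "hereditary \<FF>"
    and "subgroup_functor \<Sigma>"
    and "finite_group G"
  shows "SI \<Sigma> \<FF> G =
    product_of_normal_subgroups G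
      {N. N \<lhd> G \<and> (\<forall>H\<in>\<Sigma> G. F_subnormal \<FF> H (G\<lparr>carrier := H <#>\<^bsub>G\<^esub> N\<rparr>))}"
    (is "?S = product_of_normal_subgroups G ?\<N>")
proof -
  interpret group G using assms(4) by (simp add: finite_group_def)
  have fin: "finite (carrier G)" using assms(4) by (simp add: finite_group_def)
  note S = SI_normal[OF assms]
  have "?\<N> \<subseteq> Pow (carrier G)" using normal_imp_subgroup subgroup.subset by blast
  then have "finite ?\<N>" using fin finite_subset by blast
  \<comment> \<open>An arbitrary enumeration suffices, since the product equals the subgroup
    generated by the union of the family.\<close>
  then obtain Ns where Ns: "set Ns = ?\<N>" "distinct Ns" by (auto dest: finite_distinct_list)
  then have "product_of_normal_subgroups G ?\<N> = generate G (\<Union>?\<N>)"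
    using product_of_normal_subgroups_eq[of Ns] foldr_set_mult_normal[of Ns] by (simp flip: Ns(1)) (simp add: Ns(1))
  also have "\<dots> = ?S"
  proof
    \<comment> \<open>\<open>?S\<close> is itself a factor, in fact the largest one, so both
      inclusions reduce to comparing single members with \<open>?S\<close>.\<close>
    have "?S \<in> ?\<N>" using S F_subnormal_set_mult_SI[OF assms] by simp
    then show "?S \<subseteq> generate G (\<Union>?\<N>)" by (auto intro: generate.incl)
    have "N \<subseteq> ?S" if "N \<in> ?\<N>" for N
      using that normal_subset_F_subnormalizer[OF assms(1,2) fin] normal_imp_subgroup subgroup.subset
      by (fastforce simp: SI_def)
    then show "generate G (\<Union>?\<N>) \<subseteq> ?S"
      using normal_imp_subgroup[OF S] by (intro generate_subgroup_incl) auto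
  qed
  finally show ?thesis by simp
qed

end
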